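(* Consider an association $a(Y,\theta,U)=0$ with $U$ having a non-atomic distribution. For any fixed measurable set $A\subset\Theta$ and any fixed data $y$, there exist a nested predictive random set $\mathcal S$ satisfying $P(\gamma(U^\star)\le\alpha)\le\alpha$ for all $\alpha\in(0,1)$, where $\gamma(u)=P(u\in\mathcal S)$, and a version of the fiducial distribution, such that $\operatorname{bel}_y(A)=\operatorname{fid}_y(A)$.
   Context: **Association.** $\Theta$ is the parameter space and $Y$ has density $f(y\mid\theta)$ with respect to some dominating measure. An association is a measurable function $a(y,\theta,u)$ such that for every $\theta\in\Theta$ there exist random variables $U,Y$ on a common probability space with $a(Y,\theta,U)=0$, where $U$ has a known distribution (density $f_U$) not depending on unknown parameters and $Y$ has density $f(y\mid\theta)$. In particular, for any observed $y$ and any $\theta$ there is at least one $u_{y,\theta}$ with $a(y,\theta,u_{y,\theta})=0$. $U^\star$ denotes a random variable with the same distribution as $U$. Set $\Theta_y(u)=\{\theta: a(y,\theta,u)=0\}$. **Inferential model (IM).** A predictive random set is a random set $\mathcal S:\Omega\to 2^{R(U)}$, where $R(U)$ is the range of $U$. It is nested if any two sets in its range are comparable under inclusion. Put $\gamma(u)=P(u\in\mathcal S)$ and $\Theta_y(\mathcal S)=\bigcup_{u\in\mathcal S}\Theta_y(u)$. For an assertion $A\subset\Theta$, the belief is $$\operatorname{bel}_y(A)=P(\Theta_y(\mathcal S)\subset A\mid\Theta_y(\mathcal S)\ne\emptyset),$$ where regular outer measure is used if $\{\Theta_y(\mathcal S)\subset A\}$ is not measurable. **Generalized fiducial distribution.**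 Let $Q_y(u)\in\arg\min_{\theta}\|a(y,\theta,u)\|$ (typically the $\ell_2$ or $\ell_\infty$ norm); if there is more than one minimizer, one is selected by some possibly random rule, and different selection rules give different versions of the fiducial distribution. For $\epsilon\ge0$ let $\mathcal M_{y,\epsilon}=\{u:\|a(y,Q_y(u),u)\|\le\epsilon\}$. For $\epsilon>0$ let $U^\star_\epsilon$ have the distribution of $U$ truncated to $\mathcal M_{y,\epsilon}$ and $\theta^\star_\epsilon=Q_y(U^\star_\epsilon)$. Assuming (as part of the definition) that $\theta^\star_\epsilon$ converges in distribution as $\epsilon\to0$, with limit $\theta^\star$, the fiducial probability is $\operatorname{fid}_y(A)=P(\theta^\star\in A)$ with $y$ fixed. If $P(U^\star\in\mathcal M_{y,0})>0$ then $\operatorname{fid}_y(A)=P(Q_y(U^\star)\in A\mid U^\star\in\mathcal M_{y,0})$.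
   Formalization: Added hypothesis: if every version of the fiducial distribution has P(U* in M_{y,0}) = 0 and fid_y(A) > 0, then some u has Θ_y(u) nonempty and contained in A; without it the claim can fail, and it is implied by the conclusion. *)

theory Defs
  imports "HOL-Probability.Probability"
begin

text \<open>
  The law \<open>PU\<close> of the auxiliary variable is a probability measure on a standard Borel space whose
  underlying set \<open>space PU\<close> is the range \<open>R(U)\<close>; the parameter space \<open>\<Theta>\<close> is a Borel set in a Polish
  space, with the subspace topology.  The joint probability space carrying \<open>Y\<close> and \<open>U\<close> may depend on
  \<open>\<theta>\<close>; since only the joint law of \<open>(Y, U)\<close> matters, letting it live on \<open>'y \<times> 'u\<close> is no restriction.
  The last conjunct does not follow from the almost sure equation before it, which says nothing
  about exceptional \<open>y\<close>.
\<close>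

definition association ::
  "'y measure \<Rightarrow> ('y \<Rightarrow> 't::polish_space \<Rightarrow> ennreal) \<Rightarrow> 't set \<Rightarrow> 'u::polish_space measure \<Rightarrow>
   ('y \<Rightarrow> 't \<Rightarrow> 'u \<Rightarrow> 'e::real_normed_vector) \<Rightarrow> bool"
where
  "association \<mu> f \<Theta> PU a \<longleftrightarrow>
     \<Theta> \<in> sets borel \<and>
     prob_space PU \<and> space PU \<in> sets borel \<and> sets PU = sets (restrict_space borel (space PU)) \<and>
     (\<lambda>(y, \<theta>, u). a y \<theta> u) \<in> borel_measurable (\<mu> \<Otimes>\<^sub>M (restrict_space borel \<Theta> \<Otimes>\<^sub>M PU)) \<and>
     (\<forall>\<theta>\<in>\<Theta>. \<exists>(W :: ('y \<times> 'u) measure) Y U.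
        prob_space W \<and> distributed W \<mu> Y (\<lambda>y. f y \<theta>) \<and>
        U \<in> measurable W PU \<and> distr W PU U = PU \<and>
        (AE w in W. a (Y w) \<theta> (U w) = 0)) \<and>
     (\<forall>y\<in>space \<mu>. \<forall>\<theta>\<in>\<Theta>. \<exists>u\<in>space PU. a y \<theta> u = 0)"

definition nonatomic :: "'a measure \<Rightarrow> bool" where
  "nonatomic M \<longleftrightarrow>
     (\<forall>E\<in>sets M. 0 < emeasure M E \<longrightarrow>
        (\<exists>B\<in>sets M. B \<subseteq> E \<and> 0 < emeasure M B \<and> emeasure M B < emeasure M E))"

definition Theta_y :: "'t set \<Rightarrow> ('y \<Rightarrow> 't \<Rightarrow> 'u \<Rightarrow> 'e::zero) \<Rightarrow> 'y \<Rightarrow> 'u \<Rightarrow> 't set" where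
  "Theta_y \<Theta> a y u = {\<theta>\<in>\<Theta>. a y \<theta> u = 0}"

definition Theta_y_set :: "'t set \<Rightarrow> ('y \<Rightarrow> 't \<Rightarrow> 'u \<Rightarrow> 'e::zero) \<Rightarrow> 'y \<Rightarrow> 'u set \<Rightarrow> 't set" where
  "Theta_y_set \<Theta> a y s = (\<Union>u\<in>s. Theta_y \<Theta> a y u)"


subsection \<open>Inferential models\<close>

definition gamma_fn :: "'w measure \<Rightarrow> ('w \<Rightarrow> 'u set) \<Rightarrow> 'u \<Rightarrow> real" where
  "gamma_fn W S u = measure W {w\<in>space W. u \<in> S w}"

text \<open>
  Measurability of the events \<open>u \<in> S\<close> and of \<open>\<gamma>\<close> is demanded because \<open>measure\<close> is \<open>0\<close> on sets that
  are not measurable, which would make the validity condition below hold for the wrong reason.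
\<close>

definition predictive_random_set :: "'w measure \<Rightarrow> 'u measure \<Rightarrow> ('w \<Rightarrow> 'u set) \<Rightarrow> bool" where
  "predictive_random_set W PU S \<longleftrightarrow>
     prob_space W \<and>
     (\<forall>w\<in>space W. S w \<subseteq> space PU) \<and>
     (\<forall>u\<in>space PU. {w\<in>space W. u \<in> S w} \<in> sets W) \<and>
     gamma_fn W S \<in> borel_measurable PU"

definition nested :: "'w measure \<Rightarrow> ('w \<Rightarrow> 'u set) \<Rightarrow> bool" where
  "nested W S \<longleftrightarrow> (\<forall>w\<in>space W. \<forall>w'\<in>space W. S w \<subseteq> S w' \<or> S w' \<subseteq> S w)"

definition valid_prs :: "'w measure \<Rightarrow> 'u measure \<Rightarrow> ('w \<Rightarrow> 'u set) \<Rightarrow> bool" where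
  "valid_prs W PU S \<longleftrightarrow>
     (\<forall>\<alpha>. 0 < \<alpha> \<and> \<alpha> < 1 \<longrightarrow> measure PU {u\<in>space PU. gamma_fn W S u \<le> \<alpha>} \<le> \<alpha>)"

definition no_conflict ::
  "'w measure \<Rightarrow> ('w \<Rightarrow> 'u set) \<Rightarrow> 't set \<Rightarrow> ('y \<Rightarrow> 't \<Rightarrow> 'u \<Rightarrow> 'e::zero) \<Rightarrow> 'y \<Rightarrow> 'w set"
where
  "no_conflict W S \<Theta> a y = {w\<in>space W. Theta_y_set \<Theta> a y (S w) \<noteq> {}}"

text \<open>
  \<open>uniform_measure W B\<close> is the conditional probability \<open>W(\<cdot> | B)\<close>.  The outer measure agrees with the
  measure itself on measurable sets.  The value is meaningful only if \<open>no_conflict\<close> is an event of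
  positive probability.
\<close>

definition bel ::
  "'w measure \<Rightarrow> ('w \<Rightarrow> 'u set) \<Rightarrow> 't set \<Rightarrow> ('y \<Rightarrow> 't \<Rightarrow> 'u \<Rightarrow> 'e::zero) \<Rightarrow> 'y \<Rightarrow> 't set \<Rightarrow> real"
where
  "bel W S \<Theta> a y A =
     enn2real (outer_measure_of (uniform_measure W (no_conflict W S \<Theta> a y))
       {w\<in>space W. Theta_y_set \<Theta> a y (S w) \<subseteq> A})"


subsection \<open>Generalized fiducial distributions\<close>

text \<open>
  A possibly random selection rule is a function \<open>Q (u, v)\<close> of \<open>u\<close> and of an independent source of
  randomness \<open>v\<close> with law \<open>V\<close>; a deterministic rule ignores \<open>v\<close>.
\<close>

definition selection_rule ::
  "'t::topological_space set \<Rightarrow> 'u measure \<Rightarrow> 'v measure \<Rightarrow>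
   ('y \<Rightarrow> 't \<Rightarrow> 'u \<Rightarrow> 'e::real_normed_vector) \<Rightarrow> 'y \<Rightarrow> ('u \<times> 'v \<Rightarrow> 't) \<Rightarrow> bool"
where
  "selection_rule \<Theta> PU V a y Q \<longleftrightarrow>
     Q \<in> measurable (PU \<Otimes>\<^sub>M V) (restrict_space borel \<Theta>) \<and>
     (\<forall>u\<in>space PU. \<forall>v\<in>space V.
        is_arg_min (\<lambda>\<theta>. norm (a y \<theta> u)) (\<lambda>\<theta>. \<theta> \<in> \<Theta>) (Q (u, v)))"

text \<open>
  \<open>M_y_eps\<close> is the event that \<open>U\<close> lies in \<open>\<M>\<^sub>y\<^sub>,\<^sub>\<epsilon>\<close>, on the space carrying \<open>U\<close> and the randomness of the
  selection.  Membership does not depend on \<open>v\<close>, as all minimizers give the same norm.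
\<close>

definition M_y_eps ::
  "'u measure \<Rightarrow> 'v measure \<Rightarrow> ('y \<Rightarrow> 't \<Rightarrow> 'u \<Rightarrow> 'e::real_normed_vector) \<Rightarrow> 'y \<Rightarrow>
   ('u \<times> 'v \<Rightarrow> 't) \<Rightarrow> real \<Rightarrow> ('u \<times> 'v) set"
where
  "M_y_eps PU V a y Q \<epsilon> = {(u, v) \<in> space (PU \<Otimes>\<^sub>M V). norm (a y (Q (u, v)) u) \<le> \<epsilon>}"

definition theta_eps_law ::
  "'t::topological_space set \<Rightarrow> 'u measure \<Rightarrow> 'v measure \<Rightarrow>
   ('y \<Rightarrow> 't \<Rightarrow> 'u \<Rightarrow> 'e::real_normed_vector) \<Rightarrow> 'y \<Rightarrow> ('u \<times> 'v \<Rightarrow> 't) \<Rightarrow> real \<Rightarrow> 't measure"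
where
  "theta_eps_law \<Theta> PU V a y Q \<epsilon> =
     distr (uniform_measure (PU \<Otimes>\<^sub>M V) (M_y_eps PU V a y Q \<epsilon>)) (restrict_space borel \<Theta>) Q"

definition converges_in_distribution ::
  "'t::topological_space set \<Rightarrow> ('i \<Rightarrow> 't measure) \<Rightarrow> 't measure \<Rightarrow> 'i filter \<Rightarrow> bool"
where
  "converges_in_distribution \<Theta> L F \<FF> \<longleftrightarrow>
     (\<forall>g :: 't \<Rightarrow> real. continuous_on \<Theta> g \<and> bounded (g ` \<Theta>) \<longrightarrow>
        ((\<lambda>i. integral\<^sup>L (L i) g) \<longlongrightarrow> integral\<^sup>L F g) \<FF>)"

text \<open>
  \<open>F\<close> is the law of \<open>\<theta>\<^sup>\<star>\<close> in the version given by the rule \<open>Q\<close>, so that \<open>fid\<^sub>y(A)\<close> is \<open>measure F A\<close>.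
  Positivity of the truncation events makes the truncated laws well defined.
\<close>

definition fiducial_distribution ::
  "'t::topological_space set \<Rightarrow> 'u measure \<Rightarrow> 'v measure \<Rightarrow>
   ('y \<Rightarrow> 't \<Rightarrow> 'u \<Rightarrow> 'e::real_normed_vector) \<Rightarrow> 'y \<Rightarrow> ('u \<times> 'v \<Rightarrow> 't) \<Rightarrow> 't measure \<Rightarrow> bool"
where
  "fiducial_distribution \<Theta> PU V a y Q F \<longleftrightarrow>
     selection_rule \<Theta> PU V a y Q \<and>
     (\<forall>\<epsilon>>0. 0 < measure (PU \<Otimes>\<^sub>M V) (M_y_eps PU V a y Q \<epsilon>)) \<and>
     prob_space F \<and> sets F = sets (restrict_space borel \<Theta>) \<and>
     converges_in_distribution \<Theta> (theta_eps_law \<Theta> PU V a y Q) F (at_right 0)"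


subsection \<open>When the minimum is almost surely positive\<close>

text \<open>
  If \<open>\<M>\<^sub>y\<^sub>,\<^sub>0\<close> has probability zero, the fiducial probability of \<open>A\<close> is not determined by the sets
  \<open>\<Theta>\<^sub>y(u)\<close>, whereas belief is: \<open>bel\<^sub>y(A) > 0\<close> forces some \<open>u\<close> with \<open>{} \<noteq> \<Theta>\<^sub>y(u) \<subseteq> A\<close>.  Such a \<open>u\<close> can be
  missing although every version has \<open>fid\<^sub>y(A) > 0\<close>: let \<open>\<Theta> = {0, 1}\<close>, let \<open>U\<close> be continuous, \<open>Y = U\<close>,
  \<open>a(y, \<theta>, u) = (y - u) * (2 - \<theta>)\<close> and \<open>A = {1}\<close>.  Then \<open>\<Theta>\<^sub>y(u)\<close> is \<open>\<Theta>\<close> or empty, while the minimizer is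
  \<open>1\<close> for all \<open>u \<noteq> y\<close>, so \<open>fid\<^sub>y(A) = 1\<close> and \<open>bel\<^sub>y(A) = 0\<close>.  The following condition excludes exactly
  this situation; it is void if \<open>\<M>\<^sub>y\<^sub>,\<^sub>0\<close> has positive probability or some version has \<open>fid\<^sub>y(A) = 0\<close>,
  and it is implied by the existence of a random set \<open>S\<close> and a version with \<open>bel\<^sub>y(A) = fid\<^sub>y(A)\<close>.
\<close>

definition assertion_compatible ::
  "'t::topological_space set \<Rightarrow> 'u measure \<Rightarrow> 'v measure \<Rightarrow>
   ('y \<Rightarrow> 't \<Rightarrow> 'u \<Rightarrow> 'e::real_normed_vector) \<Rightarrow> 'y \<Rightarrow> 't set \<Rightarrow> bool"
where
  "assertion_compatible \<Theta> PU V a y A \<longleftrightarrow>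
     ((\<forall>Q F. fiducial_distribution \<Theta> PU V a y Q F \<longrightarrow>
         measure (PU \<Otimes>\<^sub>M V) (M_y_eps PU V a y Q 0) = 0 \<and> 0 < measure F A) \<longrightarrow>
      (\<exists>u\<in>space PU. Theta_y \<Theta> a y u \<noteq> {} \<and> Theta_y \<Theta> a y u \<subseteq> A))"

end

theory Submission
  imports Defs
begin

text \<open>
  Choose the version of the fiducial distribution that avoids \<open>A\<close> whenever it can: if some solution of
  \<open>a(y, \<theta>, u) = 0\<close> lies outside \<open>A\<close>, select such a solution. Then \<open>r = fid\<^sub>y(A)\<close> is at most the
  probability of a set \<open>G\<close> of \<open>u\<close> all of whose solutions lie in \<open>A\<close>, and the random set that equals \<open>G\<close>
  with probability \<open>r\<close> and the whole space otherwise is nested, valid, and has \<open>bel\<^sub>y(A) = r\<close>. The set of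
  \<open>u\<close> with a solution outside \<open>A\<close> is analytic, not Borel, so the measurable choice needs the theorem of
  Jankov and von Neumann, up to a null set. If \<open>\<M>\<^sub>y\<^sub>,\<^sub>0\<close> is null, then every version works for which
  \<open>fid\<^sub>y(A) > 0\<close>, since \<open>G\<close> may consist of the complement of \<open>\<M>\<^sub>y\<^sub>,\<^sub>0\<close> and of one \<open>u\<close> with \<open>{} \<noteq> \<Theta>\<^sub>y(u) \<subseteq> A\<close>.
\<close>

subsection \<open>Measurable selection up to null sets\<close>

text \<open>These are the analytic sets when the ambient space is Polish. The type \<open>nat discrete\<close> stands in for
  \<open>nat\<close>, which has no metric in the libraries, so that \<open>nat \<Rightarrow> nat discrete\<close> is a Polish space.\<close>

definition closed_projection :: "'a::topological_space set \<Rightarrow> bool" where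
  "closed_projection E \<longleftrightarrow> (\<exists>C :: ('a \<times> (nat \<Rightarrow> nat discrete)) set. closed C \<and> E = fst ` C)"

section \<open>Closure properties of analytic sets\<close>

lemma closed_projection_closed:
  assumes "closed E"
  shows "closed_projection E"
proof -
  have "closed (E \<times> (UNIV :: (nat \<Rightarrow> nat discrete) set))" "E = fst ` (E \<times> (UNIV :: (nat \<Rightarrow> nat discrete) set))"
    using assms by (auto intro: closed_Times)
  then show ?thesis unfolding closed_projection_def by blast
qed

text \<open>One sequence codes an index, its value at 0, and a witness for that index, its shift.
  The singletons \<open>{discrete n}\<close> are open, so requiring \<open>C n\<close> only when the
  index is \<open>n\<close> is a closed condition.\<close>

lemma closed_projection_UN:
  fixes E :: "nat \<Rightarrow> 'a::topological_space set"
  assumes "\<And>n. closed_projection (E n)"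
  shows "closed_projection (\<Union>n. E n)"
proof -
  obtain C :: "nat \<Rightarrow> ('a \<times> (nat \<Rightarrow> nat discrete)) set" where C: "\<And>n. closed (C n)" "\<And>n. E n = fst ` C n"
    using assms unfolding closed_projection_def by metis
  let ?sh = "\<lambda>p :: 'a \<times> (nat \<Rightarrow> nat discrete). (fst p, \<lambda>k. snd p (Suc k))"
  let ?z = "\<lambda>p :: 'a \<times> (nat \<Rightarrow> nat discrete). snd p 0"
  let ?D = "\<Inter>n. (?z -` (- {discrete n}) \<union> ?sh -` C n)"
  have co: "continuous_on UNIV (\<lambda>p :: 'a \<times> (nat \<Rightarrow> nat discrete). snd p i)" for i
    by (rule continuous_on_compose2[OF continuous_on_product_coordinates]) (auto intro: continuous_intros)
  have "continuous_on UNIV ?sh"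
    by (intro continuous_on_Pair continuous_on_fst continuous_on_id continuous_on_coordinatewise_then_product co)
  then have "closed ?D"
    by (intro closed_INT ballI closed_Un closed_vimage C co) (simp add: open_discrete closed_def)
  moreover have "(\<Union>n. E n) = fst ` ?D"
  proof (intro subset_antisym subsetI)
    fix x assume "x \<in> (\<Union>n. E n)"
    then obtain n s where "(x, s) \<in> C n" using C(2) by force
    then have "(x, case_nat (discrete n) s) \<in> ?D"
      by (auto simp: discrete_inject)
    then show "x \<in> fst ` ?D" by (metis (no_types, lifting) fst_conv image_eqI)
  next
    fix x assume "x \<in> fst ` ?D"
    then obtain s where s: "(x, s) \<in> ?D" by force
    obtain n where n: "s 0 = discrete n" by (cases "s 0") auto
    have "?sh (x, s) \<in> C n" using s n by auto
    then show "x \<in> (\<Union>n. E n)" using C(2) by force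
  qed
  ultimately show ?thesis unfolding closed_projection_def by blast
qed

text \<open>One sequence codes countably many: its entries at \<open>prod_encode (n, k)\<close> form
  the witness for \<open>n\<close>, so the closed conditions can be imposed all at once.\<close>

lemma closed_projection_INT:
  fixes E :: "nat \<Rightarrow> 'a::topological_space set"
  assumes "\<And>n. closed_projection (E n)"
  shows "closed_projection (\<Inter>n. E n)"
proof -
  obtain C :: "nat \<Rightarrow> ('a \<times> (nat \<Rightarrow> nat discrete)) set" where C: "\<And>n. closed (C n)" "\<And>n. E n = fst ` C n"
    using assms unfolding closed_projection_def by metis
  let ?sh = "\<lambda>n (p :: 'a \<times> (nat \<Rightarrow> nat discrete)). (fst p, \<lambda>k. snd p (prod_encode (n, k)))"
  let ?D = "\<Inter>n. ?sh n -` C n"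
  have co: "continuous_on UNIV (\<lambda>p :: 'a \<times> (nat \<Rightarrow> nat discrete). snd p i)" for i
    by (rule continuous_on_compose2[OF continuous_on_product_coordinates]) (auto intro: continuous_intros)
  have "continuous_on UNIV (?sh n)" for n
    by (intro continuous_on_Pair continuous_on_fst continuous_on_id continuous_on_coordinatewise_then_product co)
  then have "closed ?D"
    by (intro closed_INT ballI closed_vimage C)
  moreover have "(\<Inter>n. E n) = fst ` ?D"
  proof (intro subset_antisym subsetI)
    fix x assume "x \<in> (\<Inter>n. E n)"
    then have "\<forall>n. \<exists>s. (x, s) \<in> C n" using C(2) by force
    then obtain s where s: "\<And>n. (x, s n) \<in> C n" by metis
    then have "(x, \<lambda>j. case_prod s (prod_decode j)) \<in> ?D"
      by simp
    then show "x \<in> fst ` ?D" by (metis (no_types, lifting) fst_conv image_eqI)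
  next
    fix x assume "x \<in> fst ` ?D"
    then obtain s where s: "(x, s) \<in> ?D" by force
    then have "?sh n (x, s) \<in> C n" for n by blast
    then show "x \<in> (\<Inter>n. E n)" using C(2) by force
  qed
  ultimately show ?thesis unfolding closed_projection_def by blast
qed

lemma closed_projection_open:
  fixes U :: "'a::metric_space set"
  assumes "open U"
  shows "closed_projection U"
\<comment> \<open>The whole space is separate because \<open>infdist\<close> to the empty set is 0;
  any other open set is a countable union of closed sets cut out by the distance to its
  complement.\<close>
proof (cases "U = UNIV")
  case True
  then show ?thesis by (simp add: closed_projection_closed)
next
  case False
  have "x \<in> U \<longleftrightarrow> (\<exists>n. inverse (real (Suc n)) \<le> infdist x (- U))" for x
  proof
    assume "x \<in> U"
    then have "infdist x (- U) > 0"
      using assms False by (intro infdist_pos_not_in_closed) (auto simp: closed_def)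
    then show "\<exists>n. inverse (real (Suc n)) \<le> infdist x (- U)"
      using reals_Archimedean less_imp_le by blast
  next
    assume "\<exists>n. inverse (real (Suc n)) \<le> infdist x (- U)"
    then have "infdist x (- U) \<noteq> 0"
      by (metis inverse_positive_iff_positive not_le of_nat_0_less_iff zero_less_Suc)
    then show "x \<in> U" using infdist_zero[of x "- U"] by blast
  qed
  then have U: "U = (\<Union>n. {x. inverse (real (Suc n)) \<le> infdist x (- U)})" by blast
  show ?thesis
    by (subst U, intro closed_projection_UN closed_projection_closed closed_Collect_le continuous_intros)
qed

lemma borel_imp_closed_projection:
  fixes E :: "'a::metric_space set"
  assumes "E \<in> sets borel"
  shows "closed_projection E"
proof -
  have "E \<in> sigma_sets UNIV (Collect open)"
    using assms by (simp add: borel_def)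
  \<comment> \<open>Complements are carried along in the induction, since the class of analytic sets
    is not closed under them.\<close>
  then have "closed_projection E \<and> closed_projection (- E)"
  proof induction
    case (Basic a)
    then show ?case by (simp add: closed_projection_open closed_projection_closed closed_def)
  next
    case Empty
    then show ?case by (simp add: closed_projection_closed)
  next
    case (Compl a)
    then show ?case by (simp add: Compl_eq_Diff_UNIV[symmetric])
  next
    case (Union a)
    then show ?case
      by (auto simp: Compl_UN intro: closed_projection_UN closed_projection_INT)
  qed
  then show ?thesis ..
qed

section \<open>Compactness and projections of closed sets\<close>

lemma convergent_subseq_totally_bounded_tails:
  fixes z :: "nat \<Rightarrow> 'z::complete_space"
  assumes "\<And>e. 0 < e \<Longrightarrow> \<exists>N F. finite F \<and> z ` {N..} \<subseteq> (\<Union>x\<in>F. ball x e)"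
  obtains l r where "strict_mono r" "(z \<circ> r) \<longlonglongrightarrow> l"
proof -
  have "compact (closure (range z))"
    unfolding compact_eq_totally_bounded complete_eq_closed
  proof (intro conjI allI impI)
    show "closed (closure (range z))" by simp
    fix e :: real assume e: "0 < e"
    then obtain N F where F: "finite F" "z ` {N..} \<subseteq> (\<Union>x\<in>F. ball x (e/2))"
      using assms[of "e/2"] by auto
    let ?F = "F \<union> z ` {..<N}"
    \<comment> \<open>Closed balls of half the radius also cover the closure of the range; the
      finitely many terms before \<open>N\<close> serve as additional centres.\<close>
    have "range z \<subseteq> (\<Union>x\<in>?F. cball x (e/2))"
    proof
      fix w assume "w \<in> range z"
      then obtain k where k: "w = z k" by auto
      show "w \<in> (\<Union>x\<in>?F. cball x (e/2))"
      proof (cases "k < N")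
        case True
        then show ?thesis using k e by (intro UN_I[of "z k"]) auto
      next
        case False
        then have "w \<in> z ` {N..}" using k by simp
        then have "w \<in> (\<Union>x\<in>F. ball x (e/2))" using F(2) by (rule subsetD[rotated])
        then obtain x where "x \<in> F" "w \<in> ball x (e/2)" by blast
        then show ?thesis by (intro UN_I[of x]) auto
      qed
    qed
    then have "closure (range z) \<subseteq> (\<Union>x\<in>?F. cball x (e/2))"
      using F by (intro closure_minimal closed_UN) auto
    also have "\<dots> \<subseteq> (\<Union>x\<in>?F. ball x e)" using e by fastforce
    finally show "\<exists>k. finite k \<and> closure (range z) \<subseteq> (\<Union>x\<in>k. ball x e)"
      using F(1) by (intro exI[of _ ?F]) auto
  qed
  moreover have "\<forall>n. z n \<in> closure (range z)" using closure_subset[of "range z"] by blast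
  ultimately show ?thesis
    using that unfolding compact_def by metis
qed

text \<open>Choose points of \<open>C\<close> whose first coordinates tend to \<open>x\<close> and
  whose second coordinates lie in \<open>L k\<close>. The covering condition makes a subsequence of
  the latter converge, and closedness keeps the limit in \<open>C\<close> and in every
  \<open>L k\<close>.\<close>

lemma Inter_closure_projection_subset:
  fixes C :: "('x::metric_space \<times> 'z::complete_space) set"
  assumes "closed C" and "decseq L" and "\<And>k. closed (L k)"
    and tb: "\<And>e. 0 < e \<Longrightarrow> \<exists>k F. finite F \<and> L k \<subseteq> (\<Union>x\<in>F. ball x e)"
  shows "(\<Inter>k. closure (fst ` (C \<inter> UNIV \<times> L k))) \<subseteq> fst ` (C \<inter> UNIV \<times> (\<Inter>k. L k))"
proof
  fix x assume x: "x \<in> (\<Inter>k. closure (fst ` (C \<inter> UNIV \<times> L k)))"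
  have "\<exists>p. p \<in> C \<and> snd p \<in> L k \<and> dist (fst p) x < inverse (real (Suc k))" for k
  proof -
    have "x \<in> closure (fst ` (C \<inter> UNIV \<times> L k))" using x by blast
    then obtain w where "w \<in> fst ` (C \<inter> UNIV \<times> L k)" "dist w x < inverse (real (Suc k))"
      unfolding closure_approachable by (metis inverse_positive_iff_positive of_nat_0_less_iff zero_less_Suc)
    then obtain z where "(w, z) \<in> C" "z \<in> L k" by auto
    with \<open>dist w x < _\<close> show ?thesis by (intro exI[of _ "(w, z)"]) auto
  qed
  then obtain p where p: "\<And>k. p k \<in> C" "\<And>k. snd (p k) \<in> L k"
    "\<And>k. dist (fst (p k)) x < inverse (real (Suc k))" by metis
  have "(\<lambda>k. dist (fst (p k)) x) \<longlonglongrightarrow> 0"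
    by (rule tendsto_sandwich[OF _ _ tendsto_const LIMSEQ_inverse_real_of_nat])
       (intro always_eventually allI zero_le_dist less_imp_le[OF p(3)])+
  then have limx: "(\<lambda>k. fst (p k)) \<longlonglongrightarrow> x" by (rule tendsto_dist_iff[THEN iffD2])
  have "\<exists>N F. finite F \<and> (snd \<circ> p) ` {N..} \<subseteq> (\<Union>x\<in>F. ball x e)" if "0 < e" for e
  proof -
    obtain k F where "finite F" "L k \<subseteq> (\<Union>x\<in>F. ball x e)" using tb[OF \<open>0 < e\<close>] by blast
    moreover have "(snd \<circ> p) ` {k..} \<subseteq> L k"
      using p(2) \<open>decseq L\<close> by (auto simp: decseq_def)
    ultimately show ?thesis by blast
  qed
  then obtain l r where r: "strict_mono r" "((snd \<circ> p) \<circ> r) \<longlonglongrightarrow> l"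
    by (rule convergent_subseq_totally_bounded_tails)
  have lL: "l \<in> L k" for k
  \<comment> \<open>As \<open>r (n + k) \<ge> n + k \<ge> k\<close>, dropping the first
    \<open>k\<close> terms of the subsequence leaves a sequence in \<open>L k\<close>.\<close>
  proof (rule closed_sequentially[OF assms(3)])
    show "(\<lambda>n. ((snd \<circ> p) \<circ> r) (n + k)) \<longlonglongrightarrow> l"
      using r(2) by (rule LIMSEQ_ignore_initial_segment)
    show "((snd \<circ> p) \<circ> r) (n + k) \<in> L k" for n
      using p(2)[of "r (n + k)"] decseqD[OF \<open>decseq L\<close>, of k "r (n + k)"]
        seq_suble[OF r(1), of "n + k"] by auto
  qed
  have "(\<lambda>n. fst (p (r n))) \<longlonglongrightarrow> x"
    using LIMSEQ_subseq_LIMSEQ[OF limx r(1)] by (simp add: o_def)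
  then have "(\<lambda>n. (fst (p (r n)), snd (p (r n)))) \<longlonglongrightarrow> (x, l)"
    using r(2) by (intro tendsto_Pair) (simp_all add: o_def)
  then have "(\<lambda>n. p (r n)) \<longlonglongrightarrow> (x, l)" by simp
  with \<open>closed C\<close> p(1) have "(x, l) \<in> C"
    by (rule closed_sequentially)
  then have "(x, l) \<in> C \<inter> UNIV \<times> (\<Inter>k. L k)" using lL by simp
  then show "x \<in> fst ` (C \<inter> UNIV \<times> (\<Inter>k. L k))" by (metis fst_conv image_eqI)
qed

text \<open>The preceding lemma for the constant sequence \<open>K\<close>, whose finite covers come
  from compactness.\<close>

lemma closed_fst_image_compact:
  fixes C :: "('x::metric_space \<times> 'z::complete_space) set"
  assumes "closed C" and "compact K"
  shows "closed (fst ` (C \<inter> UNIV \<times> K))"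
proof -
  have "(\<Inter>k::nat. closure (fst ` (C \<inter> UNIV \<times> K))) \<subseteq> fst ` (C \<inter> UNIV \<times> (\<Inter>k::nat. K))"
    using assms
    by (intro Inter_closure_projection_subset)
       (auto simp: decseq_def compact_imp_closed compact_eq_totally_bounded)
  then show ?thesis by (simp add: closure_subset_eq)
qed

section \<open>Inner approximation by compact sets and measurable choice\<close>

lemma dense_sequence:
  obtains d :: "nat \<Rightarrow> 'z::{metric_space, second_countable_topology}"
  where "\<And>x e. 0 < e \<Longrightarrow> \<exists>i. x \<in> ball (d i) e"
proof -
  obtain D :: "'z set" where D: "countable D" "\<And>X. open X \<Longrightarrow> X \<noteq> {} \<Longrightarrow> \<exists>d\<in>D. d \<in> X"
    by (rule countable_dense_setE) blast
  have "D \<noteq> {}" using D(2)[of UNIV] by auto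
  show ?thesis
  proof (rule that[of "from_nat_into D"])
    fix x :: 'z and e :: real assume "0 < e"
    then obtain d where "d \<in> D" "d \<in> ball x e" using D(2)[of "ball x e"] by auto
    moreover then obtain i where "from_nat_into D i = d"
      using from_nat_into_surj[OF D(1)] by blast
    ultimately show "\<exists>i. x \<in> ball (from_nat_into D i) e" by (auto simp: dist_commute)
  qed
qed

text \<open>The capacitability argument: cover \<open>'z\<close> by countably many balls of radius \<open>1 / (k + 1)\<close> and, for
  \<open>k = 0, 1, \<dots>\<close> in turn, keep finitely many of them so that the outer measure of the projection stays
  above \<open>c\<close>. What survives all steps is totally bounded.\<close>

lemma projection_inner_compact:
  fixes C :: "('x::metric_space \<times> 'z::{complete_space, second_countable_topology}) set"
  assumes "finite_measure M" and sM: "sets M = sets borel" and "closed C"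
    and c: "c < outer_measure_of M (fst ` C)"
  obtains K where "compact K" "c \<le> emeasure M (fst ` (C \<inter> UNIV \<times> K))"
proof -
  interpret finite_measure M by fact
  have spM: "space M = UNIV" using sets_eq_imp_space_eq[OF sM] by simp
  obtain d :: "nat \<Rightarrow> 'z" where d: "\<And>x e. 0 < e \<Longrightarrow> \<exists>i. x \<in> ball (d i) e"
    by (rule dense_sequence) blast
  define Z where "Z k n = (\<Union>i\<le>n. cball (d i) (inverse (real (Suc k))))" for k n
  define P where "P L = fst ` (C \<inter> UNIV \<times> L)" for L
  have Zclosed: "closed (Z k n)" for k n unfolding Z_def by (intro closed_UN) auto
  have ZU: "(\<Union>n. Z k n) = UNIV" for k
  proof -
    have "x \<in> (\<Union>n. Z k n)" for x
    proof -
      obtain i where "x \<in> ball (d i) (inverse (real (Suc k)))" using d[of "inverse (real (Suc k))" x] by auto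
      then show ?thesis unfolding Z_def using less_imp_le by (auto intro!: exI[of _ i])
    qed
    then show ?thesis by blast
  qed
  \<comment> \<open>Outer measure is continuous along increasing sequences of arbitrary sets, which
    matters because the projections may fail to be measurable.\<close>
  have step: "\<exists>n. c < outer_measure_of M (P (L \<inter> Z k n))" if L: "c < outer_measure_of M (P L)" for L k
  proof -
    have "incseq (\<lambda>n. P (L \<inter> Z k n))"
      unfolding incseq_def P_def Z_def by (intro allI impI image_mono) force
    then have "(SUP n. outer_measure_of M (P (L \<inter> Z k n))) = outer_measure_of M (\<Union>n. P (L \<inter> Z k n))"
      by (intro SUP_outer_measure_of_incseq) (simp_all add: spM)
    also have "(\<Union>n. P (L \<inter> Z k n)) = P (L \<inter> (\<Union>n. Z k n))" unfolding P_def by auto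
    finally have "c < (SUP n. outer_measure_of M (P (L \<inter> Z k n)))" using L ZU by simp
    then show ?thesis unfolding less_SUP_iff by blast
  qed
  have "\<exists>f. \<forall>k. (c < outer_measure_of M (P (f k)) \<and> closed (f k)) \<and> (\<exists>n. f (Suc k) = f k \<inter> Z k n)"
  proof (rule dependent_nat_choice)
    show "\<exists>L. c < outer_measure_of M (P L) \<and> closed L"
      using c by (intro exI[of _ UNIV]) (simp add: P_def)
    fix L k assume "c < outer_measure_of M (P L) \<and> closed L"
    then show "\<exists>L'. (c < outer_measure_of M (P L') \<and> closed L') \<and> (\<exists>n. L' = L \<inter> Z k n)"
      using step[of L k] Zclosed by (blast intro: closed_Int)
  qed
  then obtain f where f: "\<And>k. c < outer_measure_of M (P (f k))" "\<And>k. closed (f k)"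
    "\<And>k. \<exists>n. f (Suc k) = f k \<inter> Z k n" by blast
  have dec: "decseq f" by (rule decseq_SucI) (use f(3) in blast)
  have tb: "\<exists>k F. finite F \<and> f k \<subseteq> (\<Union>x\<in>F. ball x e)" if "0 < e" for e
  proof -
    obtain k where k: "inverse (real (Suc k)) < e" using reals_Archimedean[OF \<open>0 < e\<close>] by auto
    obtain n where "f (Suc k) = f k \<inter> Z k n" using f(3) by blast
    then have "f (Suc k) \<subseteq> Z k n" by blast
    also have "Z k n \<subseteq> (\<Union>x\<in>d ` {..n}. ball x e)"
      using k unfolding Z_def by (auto intro: le_less_trans)
    finally show ?thesis by (intro exI[of _ "Suc k"] exI[of _ "d ` {..n}"]) simp
  qed
  let ?K = "\<Inter>k. f k"
  have comp: "compact ?K"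
    unfolding compact_eq_totally_bounded complete_eq_closed
  proof (intro conjI allI impI)
    show "closed ?K" using f(2) by blast
    fix e :: real assume "0 < e"
    from tb[OF this] show "\<exists>k. finite k \<and> ?K \<subseteq> (\<Union>x\<in>k. ball x e)" by fast
  qed
  \<comment> \<open>Continuity from above needs measurable sets, hence the closures;
    \<open>Inter_closure_projection_subset\<close> then leads back to the projection over
    \<open>?K\<close>.\<close>
  have "(INF k. emeasure M (closure (P (f k)))) = emeasure M (\<Inter>k. closure (P (f k)))"
  proof (rule INF_emeasure_decseq)
    show "decseq (\<lambda>k. closure (P (f k)))"
      using dec unfolding decseq_def P_def by (intro allI impI closure_mono image_mono) auto
  qed (auto simp: sM)
  moreover have "c \<le> (INF k. emeasure M (closure (P (f k))))"
  proof (rule INF_greatest)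
    fix k
    have "c \<le> outer_measure_of M (P (f k))" using f(1) by (rule less_imp_le)
    also have "\<dots> \<le> outer_measure_of M (closure (P (f k)))"
      by (intro outer_measure_of_mono closure_subset)
    also have "\<dots> = emeasure M (closure (P (f k)))" by (simp add: sM)
    finally show "c \<le> emeasure M (closure (P (f k)))" .
  qed
  moreover have "emeasure M (\<Inter>k. closure (P (f k))) \<le> emeasure M (P ?K)"
    unfolding P_def using closed_fst_image_compact[OF \<open>closed C\<close> comp]
    by (intro emeasure_mono Inter_closure_projection_subset \<open>closed C\<close> dec f tb) (auto simp: sM)
  ultimately have "c \<le> emeasure M (fst ` (C \<inter> UNIV \<times> ?K))" by (simp add: P_def)
  with comp show ?thesis by (rule that)
qed

text \<open>As in the theorem of Kuratowski and Ryll-Nardzewski: at step \<open>k\<close> the fibre over \<open>x\<close> is cut down to the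
  first ball of radius \<open>1 / (k + 1)\<close> that it meets; the centres of these balls converge to \<open>s x\<close>.\<close>

lemma measurable_selection_compact:
  fixes C :: "('x::metric_space \<times> 'z::{complete_space, second_countable_topology}) set"
  assumes "closed C" and "compact K"
  obtains s where "s \<in> borel_measurable borel" "\<And>x. x \<in> fst ` (C \<inter> UNIV \<times> K) \<Longrightarrow> (x, s x) \<in> C"
proof -
  obtain d :: "nat \<Rightarrow> 'z" where d: "\<And>x e. 0 < e \<Longrightarrow> \<exists>i. x \<in> ball (d i) e"
    by (rule dense_sequence) blast
  define r where "r k = inverse (real (Suc k))" for k
  define idx where "idx k x L = (LEAST i. \<exists>z\<in>L \<inter> cball (d i) (r k). (x, z) \<in> C)" for k x L
  \<comment> \<open>Only \<open>K\<close> is cut; membership in \<open>C\<close> stays a separate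
    condition, so \<open>L k x\<close> depends on \<open>x\<close> only through the chosen indices.
    Where no ball meets the fibre the \<open>LEAST\<close> is arbitrary, which concerns only
    \<open>x\<close> outside \<open>?P\<close>.\<close>
  define L where "L = (\<lambda>k x. rec_nat K (\<lambda>k L. L \<inter> cball (d (idx k x L)) (r k)) k)"
  have L0: "L 0 x = K" and LS: "L (Suc k) x = L k x \<inter> cball (d (idx k x (L k x))) (r k)" for k x
    by (simp_all add: L_def)
  have cL: "compact (L k x)" for k x
    by (induction k) (simp_all add: L0 LS \<open>compact K\<close> compact_Int_closed)
  \<comment> \<open>The induction ranges over all closed \<open>D\<close>, since the step uses the
    hypothesis for the intersection of \<open>D\<close> with each \<open>cball (d i) (r k)\<close>;
    the index takes countably many values.\<close>
  have mL: "Measurable.pred borel (\<lambda>x. \<exists>z\<in>L k x \<inter> D. (x, z) \<in> C)" if "closed D" for k D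
    using that
  proof (induction k arbitrary: D)
    case 0
    have "{x. \<exists>z\<in>K \<inter> D. (x, z) \<in> C} = fst ` (C \<inter> UNIV \<times> (K \<inter> D))" by force
    then show ?case
      using closed_fst_image_compact[OF \<open>closed C\<close> compact_Int_closed[OF \<open>compact K\<close> 0]]
      by (simp add: L0 pred_def)
  next
    case (Suc k)
    have "(\<lambda>x. idx k x (L k x)) \<in> measurable borel (count_space UNIV)"
      unfolding idx_def by (intro measurable_Least Suc.IH) simp
    then have "Measurable.pred borel (\<lambda>x. (\<lambda>i x. \<exists>z\<in>L k x \<inter> (cball (d i) (r k) \<inter> D). (x, z) \<in> C) (idx k x (L k x)) x)"
      by (rule measurable_compose_countable[rotated]) (intro Suc.IH closed_Int closed_cball Suc.prems)
    then show ?case by (simp add: LS Int_assoc)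
  qed
  let ?P = "fst ` (C \<inter> UNIV \<times> K)"
  have mP: "?P \<in> sets borel" using closed_fst_image_compact[OF assms] by simp
  have ne: "\<exists>z\<in>L k x. (x, z) \<in> C" if "x \<in> ?P" for k x
  proof (induction k)
    case 0
    then show ?case using that by (force simp: L0)
  next
    case (Suc k)
    then obtain z where z: "z \<in> L k x" "(x, z) \<in> C" by blast
    obtain i where "z \<in> ball (d i) (r k)" using d[of "r k" z] by (auto simp: r_def)
    then have "\<exists>z\<in>L k x \<inter> cball (d i) (r k). (x, z) \<in> C" using z by auto
    then have "\<exists>z\<in>L k x \<inter> cball (d (idx k x (L k x))) (r k). (x, z) \<in> C"
      unfolding idx_def by (rule LeastI)
    then show ?case by (simp add: LS)
  qed
  have "\<exists>z. \<forall>k. z \<in> L k x \<and> (x, z) \<in> C" if "x \<in> ?P" for x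
  proof -
    have "(\<Inter>k. L k x \<inter> Pair x -` C) \<noteq> {}"
    proof -
      have dec: "decseq (\<lambda>k. L k x)" by (rule decseq_SucI) (simp add: LS)
      have cl: "closed (L k x \<inter> Pair x -` C)" for k
        by (intro closed_Int compact_imp_closed cL closed_vimage \<open>closed C\<close> continuous_intros)
      \<comment> \<open>Finite intersection property: the sets decrease, so a point found at stage
        \<open>m\<close> serves all indices up to \<open>m\<close>.\<close>
      have "K \<inter> (\<Inter>k\<in>UNIV. L k x \<inter> Pair x -` C) \<noteq> {}"
      proof (rule compact_imp_fip_image[OF \<open>compact K\<close> cl])
        fix I :: "nat set" assume "finite I"
        then obtain m where m: "I \<subseteq> {..m}" by (auto simp: finite_nat_iff_bounded_le)
        obtain z where z: "z \<in> L m x" "(x, z) \<in> C" using ne[OF \<open>x \<in> ?P\<close>] by blast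
        have "z \<in> L k x" if "k \<le> m" for k using dec z that by (auto simp: decseq_def)
        moreover from this[of 0] have "z \<in> K" by (simp add: L0)
        ultimately have "z \<in> K \<inter> (\<Inter>k\<in>I. L k x \<inter> Pair x -` C)" using z m by auto
        then show "K \<inter> (\<Inter>k\<in>I. L k x \<inter> Pair x -` C) \<noteq> {}" by blast
      qed
      then show ?thesis by blast
    qed
    then show ?thesis by auto
  qed
  then obtain t where t: "\<And>x k. x \<in> ?P \<Longrightarrow> t x \<in> L k x" "\<And>x. x \<in> ?P \<Longrightarrow> (x, t x) \<in> C" by metis
  let ?s = "\<lambda>x. if x \<in> ?P then t x else d 0"
  have "?s \<in> borel_measurable borel"
  proof (rule borel_measurable_LIMSEQ_metric)
    fix k
    have "(\<lambda>x. idx k x (L k x)) \<in> measurable borel (count_space UNIV)"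
      unfolding idx_def by (intro measurable_Least mL) simp
    then have "(\<lambda>x. d (idx k x (L k x))) \<in> borel_measurable borel"
      by (rule measurable_compose) simp
    then show "(\<lambda>x. if x \<in> ?P then d (idx k x (L k x)) else d 0) \<in> borel_measurable borel"
      using mP by (intro measurable_If_set) auto
  next
    fix x :: 'x
    show "(\<lambda>k. if x \<in> ?P then d (idx k x (L k x)) else d 0) \<longlonglongrightarrow> ?s x"
    proof (cases "x \<in> ?P")
      case True
      have "dist (d (idx k x (L k x))) (t x) \<le> r k" for k
        using t(1)[OF True, of "Suc k"] by (simp add: LS)
      then have "(\<lambda>k. dist (d (idx k x (L k x))) (t x)) \<longlonglongrightarrow> 0"
        by (intro tendsto_sandwich[OF _ _ tendsto_const LIMSEQ_inverse_real_of_nat])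
           (auto intro!: always_eventually simp: r_def)
      then have "(\<lambda>k. d (idx k x (L k x))) \<longlonglongrightarrow> t x" by (rule tendsto_dist_iff[THEN iffD2])
      then show ?thesis using True by simp
    qed simp
  qed
  then show ?thesis using t(2) by (intro that[of ?s]) auto
qed

text \<open>A Borel set of pairs is the projection of a closed set, over which compact pieces
  project onto nearly all of the outer measure. Selections over countably many pieces are glued at
  the least index whose piece contains \<open>x\<close>; what is missed lies in the null set
  \<open>R\<close>.\<close>

lemma measurable_selection_AE:
  fixes E :: "('x::metric_space \<times> 't::polish_space) set"
  assumes fM: "finite_measure M" and sM: "sets M = sets borel" and E: "E \<in> sets borel"
  obtains B s R where "B \<in> sets borel" "s \<in> borel_measurable borel" "\<And>x. x \<in> B \<Longrightarrow> (x, s x) \<in> E"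
    "R \<in> null_sets M" "fst ` E \<subseteq> B \<union> R"
proof -
  interpret finite_measure M by fact
  have spM: "space M = UNIV" using sets_eq_imp_space_eq[OF sM] by simp
  obtain C0 :: "(('x \<times> 't) \<times> (nat \<Rightarrow> nat discrete)) set" where C0: "closed C0" "E = fst ` C0"
    using borel_imp_closed_projection[OF E] unfolding closed_projection_def by blast
  \<comment> \<open>Reassociation puts the point of \<open>'t\<close> and the coding sequence
    together into the fibre over \<open>'x\<close>.\<close>
  let ?g = "\<lambda>(x, (t, \<sigma>)). ((x, t), \<sigma>) :: ('x \<times> 't) \<times> (nat \<Rightarrow> nat discrete)"
  define C where "C = ?g -` C0"
  have C: "closed C"
    unfolding C_def case_prod_beta
    by (intro closed_vimage C0 continuous_on_Pair continuous_on_fst continuous_on_snd continuous_on_id)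
  have CE: "(x, fst z) \<in> E" if "(x, z) \<in> C" for x z
    using that C0 by (cases z) (force simp: C_def)
  have "fst ` C = fst ` E"
  proof (intro subset_antisym subsetI)
    fix x assume "x \<in> fst ` C"
    then obtain z where "(x, z) \<in> C" by auto
    then show "x \<in> fst ` E" using CE[of x z] by (metis fst_conv image_eqI)
  next
    fix x assume "x \<in> fst ` E"
    then obtain t \<sigma> where "((x, t), \<sigma>) \<in> C0" using C0(2) by auto
    then have "(x, (t, \<sigma>)) \<in> C" by (simp add: C_def)
    then show "x \<in> fst ` C" by (metis fst_conv image_eqI)
  qed
  define m where "m = outer_measure_of M (fst ` C)"
  show ?thesis
  proof (cases "m = 0")
    \<comment> \<open>There is no \<open>c\<close> strictly below 0 to approximate with; a
      measurable hull of the projection is itself null.\<close>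
    case True
    obtain T where T: "T \<in> sets M" "fst ` C \<subseteq> T" "m = emeasure M T"
      using outer_measure_of_attain[of "fst ` C" M] by (auto simp: spM m_def)
    show ?thesis
      by (rule that[of "{}" "\<lambda>_. undefined" T]) (use T True \<open>fst ` C = fst ` E\<close> in auto)
  next
    case False
    then have "0 < m" by (simp add: zero_less_iff_neq_zero)
    then obtain c where c: "\<And>n::nat. c n < m" "c \<longlonglongrightarrow> m"
      using approx_from_below_dense_linorder[of 0 m] by blast
    have "\<exists>K. compact K \<and> c n \<le> emeasure M (fst ` (C \<inter> UNIV \<times> K))" for n
      by (rule projection_inner_compact[OF fM sM C c(1)[of n, unfolded m_def]]) blast
    then obtain K where K: "\<And>n. compact (K n)" "\<And>n. c n \<le> emeasure M (fst ` (C \<inter> UNIV \<times> K n))"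
      by metis
    define P where "P n = fst ` (C \<inter> UNIV \<times> K n)" for n
    have "\<exists>s. s \<in> borel_measurable borel \<and> (\<forall>x\<in>P n. (x, s x) \<in> C)" for n
      unfolding P_def by (rule measurable_selection_compact[OF C K(1)[of n]]) blast
    then obtain s where s: "\<And>n. s n \<in> borel_measurable borel" "\<And>n x. x \<in> P n \<Longrightarrow> (x, s n x) \<in> C"
      by metis
    have mP[measurable]: "P n \<in> sets borel" for n
      unfolding P_def by (intro borel_closed closed_fst_image_compact C K)
    let ?B = "\<Union>n. P n"
    let ?N = "\<lambda>x. LEAST n. x \<in> P n"
    let ?s = "\<lambda>x. fst (s (?N x) x)"
    \<comment> \<open>The projection lies between \<open>?B\<close> and its hull \<open>T\<close>.
      Both turn out to have the finite measure \<open>m\<close>, so their difference is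
      null.\<close>
    obtain T where T: "T \<in> sets M" "fst ` C \<subseteq> T" "m = emeasure M T"
      using outer_measure_of_attain[of "fst ` C" M] by (auto simp: spM m_def)
    have B: "?B \<in> sets M" unfolding sM by measurable
    have BT: "?B \<subseteq> T" using T(2) by (auto simp: P_def)
    show ?thesis
    proof (rule that[of ?B ?s "T - ?B"])
      show "?B \<in> sets borel" by measurable
      have "?N \<in> measurable borel (count_space UNIV)" by measurable
      with s(1) have "(\<lambda>x. s (?N x) x) \<in> borel_measurable borel"
        by (rule measurable_compose_countable)
      then show "?s \<in> borel_measurable borel"
        by (rule measurable_compose) (intro borel_measurable_continuous_onI continuous_intros)
      show "(x, ?s x) \<in> E" if "x \<in> ?B" for x
        using that by (intro CE s(2)) (auto intro: LeastI)
      have "m \<le> emeasure M ?B"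
      proof (rule LIMSEQ_le_const2[OF c(2)], intro exI allI impI)
        fix n
        have "c n \<le> emeasure M (P n)" using K(2) by (simp add: P_def)
        also have "\<dots> \<le> emeasure M ?B" using B by (intro emeasure_mono) auto
        finally show "c n \<le> emeasure M ?B" .
      qed
      then have "emeasure M (T - ?B) = 0"
        using T B BT by (subst emeasure_Diff) (auto simp: diff_eq_0_iff_ennreal less_top[symmetric])
      then show "T - ?B \<in> null_sets M" using T B by auto
      show "fst ` E \<subseteq> ?B \<union> (T - ?B)" using T(2) \<open>fst ` C = fst ` E\<close> by auto
    qed
  qed
qed


subsection \<open>Two-valued random sets\<close>

lemma measure_of_bool_bernoulli:
  assumes "0 \<le> r" "r \<le> 1"
  shows "measure (measure_pmf (map_pmf (of_bool :: bool \<Rightarrow> real) (bernoulli_pmf r))) {w. P w} =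
    (if P 1 then r else 0) + (if P 0 then 1 - r else 0)"
proof -
  have "of_bool -` {w. P w} = (if P 1 then {True} else {}) \<union> (if P 0 then {False} else {})"
    (is "_ = ?R")
  proof (rule set_eqI)
    show "b \<in> of_bool -` {w. P w} \<longleftrightarrow> b \<in> ?R" for b by (cases b) auto
  qed
  then show ?thesis
    using assms by (simp add: measure_map_pmf measure_measure_pmf_finite)
qed

text \<open>When all subsets are events, outer measure is measure, and conditioning on the whole
  space changes nothing.\<close>

lemma bel_no_conflict:
  assumes "prob_space W" "sets W = UNIV" "no_conflict W S \<Theta> a y = space W"
  shows "bel W S \<Theta> a y A = measure W {w. Theta_y_set \<Theta> a y (S w) \<subseteq> A}"
proof -
  interpret prob_space W by fact
  have sp: "space W = UNIV" using assms(2) sets.sets_into_space by blast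
  let ?D = "{w. Theta_y_set \<Theta> a y (S w) \<subseteq> A}"
  have "outer_measure_of (uniform_measure W (space W)) ?D = emeasure (uniform_measure W (space W)) ?D"
    by (simp add: assms(2))
  also have "\<dots> = emeasure W ?D"
    using assms(2) sp by (subst emeasure_uniform_measure) (auto simp: emeasure_space_1[unfolded sp] divide_ennreal_def)
  finally show ?thesis using assms(3) sp by (simp add: bel_def measure_def)
qed

text \<open>The random set is \<open>G\<close> with probability \<open>r\<close> and the whole space otherwise: then \<open>\<gamma>\<close> is \<open>1\<close> on
  \<open>G\<close> and \<open>1 - r\<close> off \<open>G\<close>, so validity amounts to \<open>r \<le> P(U \<in> G)\<close>.\<close>

lemma two_valued_random_set:
  assumes "prob_space PU" and G: "G \<in> sets PU" and r: "0 \<le> r" "r \<le> measure PU G"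
    and ne: "Theta_y_set \<Theta> a y G \<noteq> {}"
  shows "\<exists>(W :: real measure) S.
    predictive_random_set W PU S \<and> nested W S \<and> valid_prs W PU S \<and>
    no_conflict W S \<Theta> a y \<in> sets W \<and> 0 < measure W (no_conflict W S \<Theta> a y) \<and>
    bel W S \<Theta> a y A = (if Theta_y_set \<Theta> a y G \<subseteq> A then r else 0) +
      (if Theta_y_set \<Theta> a y (space PU) \<subseteq> A then 1 - r else 0)"
proof -
  interpret prob_space PU by fact
  have r1: "r \<le> 1" using r(2) prob_le_1[of G] by linarith
  have sub: "G \<subseteq> space PU" using G by (rule sets.sets_into_space)
  define W where "W = measure_pmf (map_pmf (of_bool :: bool \<Rightarrow> real) (bernoulli_pmf r))"
  define S where "S w = (if w = (1::real) then G else space PU)" for w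
  have W: "prob_space W" "sets W = UNIV" "space W = UNIV"
    by (auto simp: W_def measure_pmf.prob_space_axioms)
  have mW: "measure W {w. P w} = (if P 1 then r else 0) + (if P 0 then 1 - r else 0)" for P
    unfolding W_def using r(1) r1 by (rule measure_of_bool_bernoulli)
  have \<gamma>: "gamma_fn W S u = (if u \<in> G then 1 else 1 - r)" if "u \<in> space PU" for u
    using that by (simp add: gamma_fn_def W(3) mW S_def)
  have "gamma_fn W S \<in> borel_measurable PU"
    using G by (subst measurable_cong[OF \<gamma>]) (auto intro!: measurable_If_set)
  then have prs: "predictive_random_set W PU S"
    using W sub by (auto simp: predictive_random_set_def S_def)
  have nest: "nested W S" using sub by (auto simp: nested_def S_def)
  have valid: "valid_prs W PU S"
    unfolding valid_prs_def
  proof (intro allI impI)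
    fix \<alpha> :: real assume \<alpha>: "0 < \<alpha> \<and> \<alpha> < 1"
    have eq: "{u \<in> space PU. gamma_fn W S u \<le> \<alpha>} = (if 1 - r \<le> \<alpha> then space PU - G else {})"
      using \<alpha> by (auto simp: \<gamma> split: if_splits)
    show "measure PU {u \<in> space PU. gamma_fn W S u \<le> \<alpha>} \<le> \<alpha>"
      unfolding eq using \<alpha> r prob_compl[OF G] by auto
  qed
  \<comment> \<open>Both values of \<open>S\<close> contain \<open>G\<close>, which has solutions,
    so conflict never occurs.\<close>
  have "Theta_y_set \<Theta> a y G \<subseteq> Theta_y_set \<Theta> a y (space PU)"
    using sub by (auto simp: Theta_y_set_def)
  then have nc: "no_conflict W S \<Theta> a y = space W"
    using ne by (auto simp: no_conflict_def S_def W(3))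
  have "bel W S \<Theta> a y A = (if Theta_y_set \<Theta> a y G \<subseteq> A then r else 0) +
      (if Theta_y_set \<Theta> a y (space PU) \<subseteq> A then 1 - r else 0)"
    using bel_no_conflict[OF W(1,2) nc, of A] by (simp add: mW S_def)
  moreover have "0 < measure W (space W)"
    using prob_space.prob_space[OF W(1)] by simp
  ultimately show ?thesis
    using prs nest valid nc W(2) by (intro exI[of _ W] exI[of _ S]) auto
qed

subsection \<open>Fiducial distributions given an exact solution\<close>

lemma association_section_measurable:
  assumes "association \<mu> f \<Theta> PU a" "y \<in> space \<mu>"
  shows "(\<lambda>(\<theta>, u). a y \<theta> u) \<in> borel_measurable (restrict_space borel \<Theta> \<Otimes>\<^sub>M PU)"
proof -
  have "(\<lambda>(y, \<theta>, u). a y \<theta> u) \<in> borel_measurable (\<mu> \<Otimes>\<^sub>M (restrict_space borel \<Theta> \<Otimes>\<^sub>M PU))"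
    using assms(1) by (simp add: association_def)
  from measurable_compose[OF measurable_Pair1'[OF assms(2)] this] show ?thesis
    by (simp add: case_prod_beta')
qed

lemma selection_rule_norm_measurable:
  fixes a :: "'y \<Rightarrow> 't::topological_space \<Rightarrow> 'u \<Rightarrow> 'e::real_normed_vector"
  assumes a: "(\<lambda>(\<theta>, u). a y \<theta> u) \<in> borel_measurable (restrict_space borel \<Theta> \<Otimes>\<^sub>M PU)"
    and Q: "selection_rule \<Theta> PU V a y Q"
  shows "(\<lambda>x. norm (a y (Q x) (fst x))) \<in> borel_measurable (PU \<Otimes>\<^sub>M V)"
proof -
  have "(\<lambda>x. (Q x, fst x)) \<in> measurable (PU \<Otimes>\<^sub>M V) (restrict_space borel \<Theta> \<Otimes>\<^sub>M PU)"
    using Q by (intro measurable_Pair measurable_fst) (simp add: selection_rule_def)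
  from measurable_compose[OF this a] show ?thesis by simp
qed

lemma M_y_eps_eq:
  "M_y_eps PU V a y Q \<epsilon> = {x \<in> space (PU \<Otimes>\<^sub>M V). norm (a y (Q x) (fst x)) \<le> \<epsilon>}"
  by (auto simp: M_y_eps_def)

text \<open>The minimal norm is 0 exactly when a solution exists, so this event is the same for
  every rule.\<close>

lemma M_y_eps_0_eq:
  assumes "selection_rule \<Theta> PU V a y Q"
  shows "M_y_eps PU V a y Q 0 = {u \<in> space PU. Theta_y \<Theta> a y u \<noteq> {}} \<times> space V"
proof -
  have "a y (Q (u, v)) u = 0 \<longleftrightarrow> Theta_y \<Theta> a y u \<noteq> {}" if "u \<in> space PU" "v \<in> space V" for u v
  proof -
    have Q: "Q (u, v) \<in> \<Theta>" "\<And>\<theta>. \<theta> \<in> \<Theta> \<Longrightarrow> norm (a y (Q (u, v)) u) \<le> norm (a y \<theta> u)"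
      using assms that by (auto simp: selection_rule_def is_arg_min_linorder)
    show ?thesis
    proof
      assume "a y (Q (u, v)) u = 0"
      with Q(1) show "Theta_y \<Theta> a y u \<noteq> {}" by (auto simp: Theta_y_def)
    next
      assume "Theta_y \<Theta> a y u \<noteq> {}"
      then obtain \<theta> where "\<theta> \<in> \<Theta>" "a y \<theta> u = 0" by (auto simp: Theta_y_def)
      with Q(2)[of \<theta>] show "a y (Q (u, v)) u = 0" by simp
    qed
  qed
  then show ?thesis by (auto simp: M_y_eps_def space_pair_measure)
qed

lemma (in prob_space) integral_uniform_measure:
  fixes g :: "'a \<Rightarrow> real"
  assumes "A \<in> sets M" "0 < measure M A" "g \<in> borel_measurable M"
  shows "integral\<^sup>L (uniform_measure M A) g = (\<integral>x. indicator A x * g x \<partial>M) / measure M A"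
proof -
  have "uniform_measure M A = density M (\<lambda>x. ennreal (indicator A x / measure M A))"
  proof -
    have "indicator A x / emeasure M A = ennreal (indicator A x / measure M A)" for x
      using assms(2) divide_ennreal[of 1 "measure M A"]
      by (auto simp: emeasure_eq_measure split: split_indicator)
    then show ?thesis by (simp add: uniform_measure_def)
  qed
  then show ?thesis
    using assms by (simp add: integral_real_density)
qed

text \<open>The truncation events decrease to one of positive probability, so dominated convergence
  identifies the limit law as the conditional law given an exact solution.\<close>

lemma fiducial_distribution_conditional:
  fixes a :: "'y \<Rightarrow> 't::topological_space \<Rightarrow> 'u \<Rightarrow> 'e::real_normed_vector"
  assumes "prob_space PU" "prob_space V"
    and a: "(\<lambda>(\<theta>, u). a y \<theta> u) \<in> borel_measurable (restrict_space borel \<Theta> \<Otimes>\<^sub>M PU)"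
    and Q: "selection_rule \<Theta> PU V a y Q"
    and pos: "0 < measure (PU \<Otimes>\<^sub>M V) (M_y_eps PU V a y Q 0)"
  shows "fiducial_distribution \<Theta> PU V a y Q (theta_eps_law \<Theta> PU V a y Q 0)"
proof -
  interpret pair_prob_space PU V
    using assms(1,2) by (simp add: pair_prob_space_def pair_sigma_finite_def prob_space_imp_sigma_finite)
  let ?P = "PU \<Otimes>\<^sub>M V"
  let ?N = "restrict_space borel \<Theta>"
  let ?M = "M_y_eps PU V a y Q"
  let ?h = "\<lambda>x. norm (a y (Q x) (fst x))"
  have Qm[measurable]: "Q \<in> measurable ?P ?N" using Q by (simp add: selection_rule_def)
  have h[measurable]: "?h \<in> borel_measurable ?P" by (rule selection_rule_norm_measurable[OF a Q])
  have M[measurable]: "?M \<epsilon> \<in> sets ?P" for \<epsilon> unfolding M_y_eps_eq by measurable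
  have posM: "0 < measure ?P (?M \<epsilon>)" if "0 \<le> \<epsilon>" for \<epsilon>
  proof -
    have "measure ?P (?M 0) \<le> measure ?P (?M \<epsilon>)"
      using that by (intro finite_measure_mono M) (auto simp: M_y_eps_eq)
    with pos show ?thesis by linarith
  qed
  have "prob_space (uniform_measure ?P (?M 0))"
    using pos by (intro prob_space_uniform_measure) (auto simp: emeasure_eq_measure)
  then have "prob_space (theta_eps_law \<Theta> PU V a y Q 0)"
    unfolding theta_eps_law_def by (rule prob_space.prob_space_distr) simp
  moreover have "converges_in_distribution \<Theta> (theta_eps_law \<Theta> PU V a y Q)
      (theta_eps_law \<Theta> PU V a y Q 0) (at_right 0)"
    unfolding converges_in_distribution_def
  proof (intro allI impI)
    fix g :: "'t \<Rightarrow> real" assume g: "continuous_on \<Theta> g \<and> bounded (g ` \<Theta>)"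
    have gm: "g \<in> borel_measurable ?N"
      using g by (intro borel_measurable_continuous_on_restrict) simp
    have gQ[measurable]: "(\<lambda>x. g (Q x)) \<in> borel_measurable ?P"
      by (rule measurable_compose[OF Qm gm])
    obtain B where B: "\<And>\<theta>. \<theta> \<in> \<Theta> \<Longrightarrow> \<bar>g \<theta>\<bar> \<le> B" using g by (auto simp: bounded_iff)
    have QT: "Q x \<in> \<Theta>" if "x \<in> space ?P" for x
      using measurable_space[OF Qm that] by (simp add: space_restrict_space)
    have int: "integral\<^sup>L (theta_eps_law \<Theta> PU V a y Q \<epsilon>) g =
        (\<integral>x. indicator (?M \<epsilon>) x * g (Q x) \<partial>?P) / measure ?P (?M \<epsilon>)" if "0 \<le> \<epsilon>" for \<epsilon>
      unfolding theta_eps_law_def using gm posM[OF that]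
      by (subst integral_distr) (simp_all add: integral_uniform_measure)
    show "((\<lambda>\<epsilon>. integral\<^sup>L (theta_eps_law \<Theta> PU V a y Q \<epsilon>) g) \<longlongrightarrow>
        integral\<^sup>L (theta_eps_law \<Theta> PU V a y Q 0) g) (at_right 0)"
    proof (rule tendsto_at_right_sequentially[of 0 1])
      fix e :: "nat \<Rightarrow> real" assume e: "\<And>n. 0 < e n" "e \<longlonglongrightarrow> 0"
      \<comment> \<open>A point with \<open>?h x = 0\<close> lies in every event; any other point is
        outside as soon as \<open>e n < ?h x\<close>.\<close>
      have ind: "(\<lambda>n. indicator (?M (e n)) x) \<longlonglongrightarrow> (indicator (?M 0) x :: real)"
        if "x \<in> space ?P" for x
      proof (cases "?h x = 0")
        case True
        then show ?thesis
          using that e(1) by (auto simp: M_y_eps_eq indicator_def less_imp_le)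
      next
        case False
        then have "\<forall>\<^sub>F n in sequentially. e n < ?h x"
          by (intro order_tendstoD(2)[OF e(2)]) simp
        then have "\<forall>\<^sub>F n in sequentially. indicator (?M (e n)) x = (indicator (?M 0) x :: real)"
          by eventually_elim (use False in \<open>auto simp: M_y_eps_eq indicator_def\<close>)
        then show ?thesis by (rule tendsto_eventually)
      qed
      have "(\<lambda>n. \<integral>x. indicator (?M (e n)) x * g (Q x) \<partial>?P) \<longlonglongrightarrow> (\<integral>x. indicator (?M 0) x * g (Q x) \<partial>?P)"
      proof (rule integral_dominated_convergence[where w = "\<lambda>_. B"])
        show "AE x in ?P. (\<lambda>n. indicator (?M (e n)) x * g (Q x)) \<longlonglongrightarrow> indicator (?M 0) x * g (Q x)"
          by (intro AE_I2 tendsto_mult_right ind)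
        show "AE x in ?P. norm (indicator (?M (e n)) x * g (Q x)) \<le> B" for n
        proof (rule AE_I2)
          fix x assume "x \<in> space ?P"
          from B[OF QT[OF this]] show "norm (indicator (?M (e n)) x * g (Q x)) \<le> B"
            by (auto simp: indicator_def)
        qed
      qed auto
      moreover have "(\<lambda>n. measure ?P (?M (e n))) \<longlonglongrightarrow> measure ?P (?M 0)"
      proof -
        have "(\<lambda>n. \<integral>x. indicator (?M (e n)) x \<partial>?P) \<longlonglongrightarrow> (\<integral>x. indicator (?M 0) x \<partial>?P :: real)"
        proof (rule integral_dominated_convergence[where w = "\<lambda>_. 1"])
          show "AE x in ?P. (\<lambda>n. indicator (?M (e n)) x) \<longlonglongrightarrow> (indicator (?M 0) x :: real)"
            by (intro AE_I2 ind)
        qed auto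
        then show ?thesis by simp
      qed
      ultimately have "(\<lambda>n. (\<integral>x. indicator (?M (e n)) x * g (Q x) \<partial>?P) / measure ?P (?M (e n)))
          \<longlonglongrightarrow> (\<integral>x. indicator (?M 0) x * g (Q x) \<partial>?P) / measure ?P (?M 0)"
        using pos by (intro tendsto_divide) auto
      then show "(\<lambda>n. integral\<^sup>L (theta_eps_law \<Theta> PU V a y Q (e n)) g)
          \<longlonglongrightarrow> integral\<^sup>L (theta_eps_law \<Theta> PU V a y Q 0) g"
        using e(1) by (simp add: int less_imp_le)
    qed simp
  qed
  ultimately show ?thesis
    using Q posM by (simp add: fiducial_distribution_def theta_eps_law_def less_imp_le)
qed

text \<open>Passes from the product of the subspace sigma-algebras to Borel sets of pairs, as the
  selection lemma requires; the coordinates are swapped so that \<open>fst\<close> projects to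
  \<open>u\<close>.\<close>

lemma zeros_outside_borel:
  fixes a :: "'y \<Rightarrow> 't::second_countable_topology \<Rightarrow> 'u::second_countable_topology \<Rightarrow> 'e::real_normed_vector"
  assumes a: "(\<lambda>(\<theta>, u). a y \<theta> u) \<in> borel_measurable (restrict_space borel \<Theta> \<Otimes>\<^sub>M PU)"
    and T: "\<Theta> \<in> sets borel" and sp: "space PU \<in> sets borel"
    and PU: "sets PU = sets (restrict_space borel (space PU))"
    and A: "A \<in> sets borel"
  shows "{(u, \<theta>). u \<in> space PU \<and> \<theta> \<in> \<Theta> \<and> \<theta> \<notin> A \<and> a y \<theta> u = 0} \<in> sets borel" (is "?E \<in> _")
proof -
  let ?X = "restrict_space (borel :: ('u \<times> 't) measure) (space PU \<times> \<Theta>)"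
  have spX: "space ?X = space PU \<times> \<Theta>" by (simp add: space_restrict_space)
  have fst: "fst \<in> measurable ?X PU"
    by (subst measurable_cong_sets[OF refl PU])
       (intro measurable_restrict_space3 borel_measurable_continuous_onI continuous_on_fst continuous_on_id; auto)
  have snd: "snd \<in> measurable ?X (restrict_space borel \<Theta>)"
    by (intro measurable_restrict_space3 borel_measurable_continuous_onI continuous_on_snd continuous_on_id; auto)
  have [measurable]: "(\<lambda>x. a y (snd x) (fst x)) \<in> borel_measurable ?X"
    using measurable_compose[OF measurable_Pair[OF snd fst] a] by simp
  have [measurable]: "snd \<in> borel_measurable ?X"
    by (intro measurable_restrict_space1 borel_measurable_continuous_onI continuous_on_snd continuous_on_id)
  have "{x \<in> space ?X. snd x \<notin> A \<and> a y (snd x) (fst x) = 0} \<in> sets ?X"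
    using A by measurable
  also have "{x \<in> space ?X. snd x \<notin> A \<and> a y (snd x) (fst x) = 0} = ?E"
    by (auto simp: spX)
  finally show ?thesis
    using T sp by (subst (asm) sets_restrict_space_iff) (auto intro: borel_Times)
qed

text \<open>\<open>Q\<close> selects a solution outside \<open>A\<close> on a set \<open>B\<close> that contains almost every \<open>u\<close> for which there is one.
  With \<open>n = P(\<M>\<^sub>y\<^sub>,\<^sub>0)\<close> and \<open>b = P(B) \<le> n\<close> this gives \<open>fid\<^sub>y(A) \<le> (n - b) / n \<le> 1 - b = P(G)\<close>.\<close>

lemma exists_fiducial_avoiding:
  fixes a :: "'y \<Rightarrow> 't::polish_space \<Rightarrow> 'u::polish_space \<Rightarrow> 'e::real_normed_vector"
  assumes PU: "prob_space PU" "space PU \<in> sets borel" "sets PU = sets (restrict_space borel (space PU))"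
    and V: "prob_space V"
    and a: "(\<lambda>(\<theta>, u). a y \<theta> u) \<in> borel_measurable (restrict_space borel \<Theta> \<Otimes>\<^sub>M PU)"
    and T: "\<Theta> \<in> sets borel" and A: "A \<in> sets borel" "A \<subseteq> \<Theta>"
    and Q0: "selection_rule \<Theta> PU V a y Q0"
    and pos: "0 < measure (PU \<Otimes>\<^sub>M V) (M_y_eps PU V a y Q0 0)"
  obtains Q F G where "fiducial_distribution \<Theta> PU V a y Q F" "G \<in> sets PU" "measure F A \<le> measure PU G"
    "Theta_y_set \<Theta> a y G \<subseteq> A" "Theta_y_set \<Theta> a y G = {} \<longrightarrow> measure F A = 0"
proof -
  interpret pair_prob_space PU V
    using PU(1) V by (simp add: pair_prob_space_def pair_sigma_finite_def prob_space_imp_sigma_finite)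
  let ?P = "PU \<Otimes>\<^sub>M V"
  let ?E = "{(u, \<theta>). u \<in> space PU \<and> \<theta> \<in> \<Theta> \<and> \<theta> \<notin> A \<and> a y \<theta> u = 0}"
  define N where "N = {u \<in> space PU. Theta_y \<Theta> a y u \<noteq> {}}"
  \<comment> \<open>\<open>PU\<close> lives on a Borel subset of \<open>'u\<close>; its image under
    the identity is a Borel measure on the whole type, to which the selection lemma applies.\<close>
  have id: "(\<lambda>u. u) \<in> measurable PU borel"
    by (subst measurable_cong_sets[OF PU(3) refl]) (intro measurable_restrict_space1, simp)
  have fin: "finite_measure (distr PU borel (\<lambda>u. u))"
    by (intro M1.finite_measure_distr id)
  have E: "?E \<in> sets borel"
    using a T PU(2,3) A(1) by (rule zeros_outside_borel)
  obtain B s R where B: "B \<in> sets borel" "s \<in> borel_measurable borel" "\<And>u. u \<in> B \<Longrightarrow> (u, s u) \<in> ?E"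
    "R \<in> null_sets (distr PU borel (\<lambda>u. u))" "fst ` ?E \<subseteq> B \<union> R"
    by (rule measurable_selection_AE[OF fin sets_distr E]) blast
  have Bsub: "B \<subseteq> N" using B(3) by (auto simp: N_def Theta_y_def)
  have BU: "B \<inter> space PU = B" "N \<subseteq> space PU" using Bsub by (auto simp: N_def)
  have BPU: "B \<in> sets PU"
    using measurable_sets[OF id B(1)] BU by (simp add: vimage_def Int_def)
  have R: "R \<inter> space PU \<in> null_sets PU"
    using B(4) id by (auto simp: null_sets_distr_iff vimage_def Int_def)
  define Q where "Q x = (if fst x \<in> B then s (fst x) else Q0 x)" for x
  have Q0m: "Q0 \<in> measurable ?P (restrict_space borel \<Theta>)" using Q0 by (simp add: selection_rule_def)
  have Q0T: "Q0 x \<in> \<Theta>" if "x \<in> space ?P" for x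
    using measurable_space[OF Q0m that] by (simp add: space_restrict_space)
  have "Q \<in> borel_measurable ?P"
    unfolding Q_def
  proof (rule measurable_If)
    show "(\<lambda>x. s (fst x)) \<in> borel_measurable ?P"
      by (rule measurable_compose[OF measurable_fst measurable_compose[OF id B(2)]])
    show "Q0 \<in> borel_measurable ?P"
      using Q0m by (simp add: measurable_restrict_space2_iff)
    have "fst -` B \<inter> space ?P \<in> sets ?P" by (rule measurable_sets[OF measurable_fst BPU])
    then show "{x \<in> space ?P. fst x \<in> B} \<in> sets ?P" by (simp add: vimage_def Int_def conj_commute)
  qed
  moreover have "Q x \<in> \<Theta>" if "x \<in> space ?P" for x
    using Q0T[OF that] B(3) by (auto simp: Q_def)
  ultimately have Qm: "Q \<in> measurable ?P (restrict_space borel \<Theta>)"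
    by (intro measurable_restrict_space2) auto
  have "is_arg_min (\<lambda>\<theta>. norm (a y \<theta> u)) (\<lambda>\<theta>. \<theta> \<in> \<Theta>) (Q (u, v))"
    if "u \<in> space PU" "v \<in> space V" for u v
  proof (cases "u \<in> B")
    case True
    then show ?thesis using B(3)[OF True] by (simp add: Q_def is_arg_min_def)
  next
    case False
    then show ?thesis using Q0 that by (simp add: Q_def selection_rule_def)
  qed
  with Qm have Q: "selection_rule \<Theta> PU V a y Q" by (simp add: selection_rule_def)
  have M0: "M_y_eps PU V a y Q 0 = N \<times> space V" "M_y_eps PU V a y Q0 0 = N \<times> space V"
    using M_y_eps_0_eq[OF Q] M_y_eps_0_eq[OF Q0] by (simp_all add: N_def)
  have MS: "N \<times> space V \<in> sets ?P"
    using selection_rule_norm_measurable[OF a Q] unfolding M0(1)[symmetric] M_y_eps_eq by measurable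
  \<comment> \<open>\<open>N\<close> is a projection, so its measurability is not evident. It is a
    section of the truncation event, which is measurable because a measurable rule exists.\<close>
  obtain v where v: "v \<in> space V" using M2.not_empty by blast
  have "(\<lambda>u. (u, v)) -` (N \<times> space V) = N" using v by auto
  then have NPU: "N \<in> sets PU" using sets_Pair2[OF MS, of v] by simp
  have mN: "measure ?P (C \<times> space V) = measure PU C" if "C \<in> sets PU" for C
    using that by (simp add: measure_def M2.emeasure_pair_measure_Times M2.emeasure_space_1)
  define n b where "n = measure PU N" and "b = measure PU B"
  have n: "0 < n" "n \<le> 1" and b: "b \<le> n"
    using pos mN[OF NPU] M0 Bsub NPU by (auto simp: n_def b_def intro: M1.finite_measure_mono)
  let ?F = "theta_eps_law \<Theta> PU V a y Q 0"
  have "fiducial_distribution \<Theta> PU V a y Q ?F"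
    using pos M0 by (intro fiducial_distribution_conditional PU V a Q) simp
  have "measure ?F A = measure (uniform_measure ?P (N \<times> space V)) (Q -` A \<inter> space ?P)"
    unfolding theta_eps_law_def M0
    using Qm A T by (subst measure_distr) (auto simp: sets_restrict_space_iff)
  also have "\<dots> = measure ?P ((N \<times> space V) \<inter> (Q -` A \<inter> space ?P)) / n"
  proof (subst measure_uniform_measure)
    show "Q -` A \<inter> space ?P \<in> sets ?P"
      using measurable_sets[OF \<open>Q \<in> borel_measurable ?P\<close> A(1)] .
  qed (use n mN[OF NPU] in \<open>auto simp: n_def emeasure_eq_measure\<close>)
  also have "\<dots> \<le> measure ?P ((N - B) \<times> space V) / n"
  proof (intro divide_right_mono finite_measure_mono)
    show "(N \<times> space V) \<inter> (Q -` A \<inter> space ?P) \<subseteq> (N - B) \<times> space V"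
      using B(3) by (auto simp: Q_def)
  qed (use n NPU BPU in auto)
  also have "\<dots> = (n - b) / n"
    using NPU BPU Bsub by (simp add: mN M1.finite_measure_Diff n_def b_def)
  finally have FA: "measure ?F A \<le> (n - b) / n" .
  also have "\<dots> \<le> 1 - b"
  proof -
    have "n * b \<le> 1 * b" using n by (intro mult_right_mono) (auto simp: b_def)
    then show ?thesis using n by (simp add: field_simps)
  qed
  finally have FA1: "measure ?F A \<le> 1 - b" .
  \<comment> \<open>\<open>R\<close> is removed too: a \<open>u\<close> in it may have a solution
    outside \<open>A\<close> without lying in \<open>B\<close>.\<close>
  let ?G = "space PU - (B \<union> (R \<inter> space PU))"
  have G: "?G \<in> sets PU" using BPU R by auto
  have "measure PU ?G = 1 - b"
  proof -
    have "measure PU (B \<union> (R \<inter> space PU)) = b"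
      using BPU R unfolding b_def by (simp add: measure_Un_null_set)
    then show ?thesis using BPU R by (subst M1.prob_compl) auto
  qed
  moreover have "Theta_y_set \<Theta> a y ?G \<subseteq> A"
    using B(5) by (force simp: Theta_y_set_def Theta_y_def)
  \<comment> \<open>Without solutions over \<open>?G\<close>, the set \<open>N\<close> lies in
    \<open>B\<close> up to a null set; then \<open>b = n\<close> and the bound
    \<open>(n - b) / n\<close> vanishes.\<close>
  moreover have "measure ?F A = 0" if "Theta_y_set \<Theta> a y ?G = {}"
  proof -
    have "N \<subseteq> B \<union> (R \<inter> space PU)" using that by (auto simp: Theta_y_set_def N_def)
    then have "n \<le> measure PU (B \<union> (R \<inter> space PU))"
      unfolding n_def using BPU R by (intro M1.finite_measure_mono) auto
    also have "\<dots> = b" using BPU R unfolding b_def by (simp add: measure_Un_null_set)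
    finally show ?thesis using FA b n by (simp add: antisym)
  qed
  ultimately show ?thesis
    using that[OF \<open>fiducial_distribution \<Theta> PU V a y Q ?F\<close> G] FA1 by auto
qed

section \<open>Assembly by cases on \<open>A\<close> and on the event of an exact solution\<close>

theorem theorem3p2:
  fixes \<mu> :: "'y measure"
    and f :: "'y \<Rightarrow> 't::polish_space \<Rightarrow> ennreal"
    and \<Theta> :: "'t set"
    and PU :: "'u::polish_space measure"
    and V :: "'v measure"
    and a :: "'y \<Rightarrow> 't \<Rightarrow> 'u \<Rightarrow> 'e::real_normed_vector"
    and y :: 'y
    and A :: "'t set"
  assumes "association \<mu> f \<Theta> PU a"
    and "nonatomic PU"
    and "y \<in> space \<mu>"
    and "A \<in> sets (restrict_space borel \<Theta>)"
    and "prob_space V"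
    and "\<exists>Q F. fiducial_distribution \<Theta> PU V a y Q F"
    and "assertion_compatible \<Theta> PU V a y A"
  shows "\<exists>(W :: real measure) S Q F.
           predictive_random_set W PU S \<and> nested W S \<and> valid_prs W PU S \<and>
           no_conflict W S \<Theta> a y \<in> sets W \<and> 0 < measure W (no_conflict W S \<Theta> a y) \<and>
           fiducial_distribution \<Theta> PU V a y Q F \<and>
           bel W S \<Theta> a y A = measure F A"
proof -
  have PU: "prob_space PU" "space PU \<in> sets borel" "sets PU = sets (restrict_space borel (space PU))"
    and T: "\<Theta> \<in> sets borel"
    using assms(1) by (auto simp: association_def)
  interpret prob_space PU by fact
  have A: "A \<in> sets borel" "A \<subseteq> \<Theta>" using assms(4) T by (auto simp: sets_restrict_space_iff)
  have a: "(\<lambda>(\<theta>, u). a y \<theta> u) \<in> borel_measurable (restrict_space borel \<Theta> \<Otimes>\<^sub>M PU)"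
    by (rule association_section_measurable[OF assms(1,3)])
  have "\<forall>\<theta>\<in>\<Theta>. \<exists>u\<in>space PU. a y \<theta> u = 0" using assms(1,3) by (simp add: association_def)
  then have full: "Theta_y_set \<Theta> a y (space PU) = \<Theta>" by (auto simp: Theta_y_set_def Theta_y_def)
  have F: "prob_space F" "space F = \<Theta>" if "fiducial_distribution \<Theta> PU V a y Q F" for Q F
    using that sets_eq_imp_space_eq[of F "restrict_space borel \<Theta>"]
    by (auto simp: fiducial_distribution_def space_restrict_space)
  obtain Q0 F0 where QF0: "fiducial_distribution \<Theta> PU V a y Q0 F0" using assms(6) by blast
  then have Q0: "selection_rule \<Theta> PU V a y Q0" by (simp add: fiducial_distribution_def)
  have Tne: "\<Theta> \<noteq> {}" using prob_space.not_empty[OF F(1)[OF QF0]] F(2)[OF QF0] by simp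
  \<comment> \<open>Every case ends here: it remains to supply \<open>G\<close> and \<open>r\<close>
    such that the fiducial probability equals the belief given by
    \<open>two_valued_random_set\<close>.\<close>
  have conclude: ?thesis
    if "fiducial_distribution \<Theta> PU V a y Q F" "G \<in> sets PU" "0 \<le> r" "r \<le> measure PU G"
      "Theta_y_set \<Theta> a y G \<noteq> {}"
      "measure F A = (if Theta_y_set \<Theta> a y G \<subseteq> A then r else 0) + (if \<Theta> \<subseteq> A then 1 - r else 0)"
    for Q F G r
    using two_valued_random_set[OF PU(1) that(2-5), of A] that(1,6) unfolding full by metis
  show ?thesis
  proof (cases "\<Theta> \<subseteq> A")
    \<comment> \<open>Here \<open>A = \<Theta>\<close>, and both probabilities are 1.\<close>
    case True
    then have "measure F0 A = 1"
      using A prob_space.prob_space[OF F(1)[OF QF0]] F(2)[OF QF0] by (metis subset_antisym)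
    then show ?thesis
      using True Tne by (intro conclude[OF QF0 sets.top, of 1]) (auto simp: full prob_space)
  next
    case notfull: False
    show ?thesis
    proof (cases "\<exists>Q F. fiducial_distribution \<Theta> PU V a y Q F \<and> measure F A = 0")
      case True
      \<comment> \<open>The random set is the whole space; its solution set \<open>\<Theta>\<close>
        is not contained in \<open>A\<close>, so the belief is 0 as well.\<close>
      then obtain Q F where "fiducial_distribution \<Theta> PU V a y Q F" "measure F A = 0" by blast
      then show ?thesis
        using notfull Tne by (intro conclude[of Q F "space PU" 1]) (auto simp: full prob_space)
    next
      case nonzero: False
      show ?thesis
      \<comment> \<open>By \<open>M_y_eps_0_eq\<close> the event is the same for all rules, so
        deciding the case for \<open>Q0\<close> decides it for every version.\<close>
      proof (cases "0 < measure (PU \<Otimes>\<^sub>M V) (M_y_eps PU V a y Q0 0)")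
        case True
        obtain Q F G where "fiducial_distribution \<Theta> PU V a y Q F" "G \<in> sets PU" "measure F A \<le> measure PU G"
          "Theta_y_set \<Theta> a y G \<subseteq> A" "Theta_y_set \<Theta> a y G = {} \<longrightarrow> measure F A = 0"
          by (rule exists_fiducial_avoiding[OF PU assms(5) a T A Q0 True])
        then show ?thesis
          using nonzero notfull by (intro conclude[of Q F G "measure F A"]) auto
      next
        case null: False
        interpret P: pair_prob_space PU V
          using PU(1) assms(5) by (simp add: pair_prob_space_def pair_sigma_finite_def prob_space_imp_sigma_finite)
        define N where "N = {u \<in> space PU. Theta_y \<Theta> a y u \<noteq> {}}"
        have M0: "M_y_eps PU V a y Q 0 = N \<times> space V" if "selection_rule \<Theta> PU V a y Q" for Q
          using M_y_eps_0_eq[OF that] by (simp add: N_def)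
        have m0: "measure (PU \<Otimes>\<^sub>M V) (N \<times> space V) = 0"
          using null M0[OF Q0] by (simp add: zero_less_measure_iff)
        \<comment> \<open>The premise of \<open>assertion_compatible\<close> speaks of all versions:
          nullity passes from \<open>Q0\<close> to every rule, and positivity is the assumption
          \<open>nonzero\<close>.\<close>
        have "measure (PU \<Otimes>\<^sub>M V) (M_y_eps PU V a y Q 0) = 0 \<and> 0 < measure F A"
          if "fiducial_distribution \<Theta> PU V a y Q F" for Q F
          using nonzero that M0[of Q] m0 by (auto simp: fiducial_distribution_def zero_less_measure_iff)
        then obtain u0 where u0: "u0 \<in> space PU" "Theta_y \<Theta> a y u0 \<noteq> {}" "Theta_y \<Theta> a y u0 \<subseteq> A"
          using assms(7) unfolding assertion_compatible_def by blast
        have MS: "N \<times> space V \<in> sets (PU \<Otimes>\<^sub>M V)"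
          using selection_rule_norm_measurable[OF a Q0] unfolding M0[OF Q0, symmetric] M_y_eps_eq by measurable
        obtain v where v: "v \<in> space V" using P.M2.not_empty by blast
        have "(\<lambda>u. (u, v)) -` (N \<times> space V) = N" using v by auto
        then have NPU: "N \<in> sets PU" using sets_Pair2[OF MS, of v] by simp
        have "{u0} \<in> sets PU" using u0(1) PU(2) by (subst PU(3)) (auto simp: sets_restrict_space_iff)
        let ?G = "{u0} \<union> (space PU - N)"
        have G: "?G \<in> sets PU" using \<open>{u0} \<in> sets PU\<close> NPU by (intro sets.Un sets.compl_sets)
        have "measure PU N = 0"
          using m0 NPU by (simp add: measure_def P.M2.emeasure_pair_measure_Times P.M2.emeasure_space_1)
        then have "1 \<le> measure PU ?G"
          using prob_compl[OF NPU] G finite_measure_mono[of "space PU - N" ?G] by auto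
        moreover have "Theta_y_set \<Theta> a y ?G = Theta_y \<Theta> a y u0"
          by (auto simp: Theta_y_set_def N_def)
        ultimately show ?thesis
          using u0 notfull prob_space.prob_le_1[OF F(1)[OF QF0], of A]
          by (intro conclude[OF QF0 G, of "measure F0 A"]) auto
      qed
    qed
  qed
qed

end
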